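(* The $(2,1)$-bin sequence is not a Positive Linear Recurrence Sequence (PLRS).
   Context: The terms $a_0<a_1<a_2<\cdots$ of an increasing sequence of positive integers are divided, in order, into consecutive bins whose sizes alternate $2,1,2,1,\ldots$: $\{a_0,a_1\},\{a_2\},\{a_3,a_4\},\{a_5\},\ldots$. Two bins are adjacent if they are consecutive in this ordering. A $(2,1)$-bin legal decomposition of an integer is an expression of it as a sum of terms of the sequence in which no two summands are from the same bin or from adjacent bins. The $(2,1)$-bin sequence is the unique increasing sequence of positive integers $\{a_x\}_{x=0}^\infty$ such that every positive integer has a unique $(2,1)$-bin legal decomposition. A sequence of positive integers $\{H_j\}_{j=1}^\infty$ is a Positive Linear Recurrence Sequence (PLRS) if (1) there are nonnegative integers $L,c_1,\ldots,c_L$ with $L,c_1,c_L$ positive such that $H_{j+1}=c_1H_j+c_2H_{j-1}+\cdots+c_LH_{j+1-L}$ for all $j\ge L$; and (2) $H_1=1$ and for $1\le j<L$, $H_{j+1}=c_1H_j+c_2H_{j-1}+\cdots+c_jH_1+1$. For the bin sequence one takes $H_j=a_{j-1}$. *)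

theory Defs
  imports Main
begin

text \<open>The bins are numbered from \<open>0\<close>. Bin \<open>2 * k\<close> holds the terms with indices \<open>3 * k\<close> and
  \<open>3 * k + 1\<close>; bin \<open>2 * k + 1\<close> holds the term with index \<open>3 * k + 2\<close>.\<close>

definition bin_of :: "nat \<Rightarrow> nat" where
  "bin_of x = 2 * (x div 3) + (if x mod 3 = 2 then 1 else 0)"

definition adjacent_bins :: "nat \<Rightarrow> nat \<Rightarrow> bool" where
  "adjacent_bins b b' \<longleftrightarrow> b' = Suc b \<or> b = Suc b'"

text \<open>A decomposition is represented by the finite set of indices of its summands. A set suffices,
  because a repeated summand would give two summands from the same bin.\<close>

definition bin21_legal :: "nat set \<Rightarrow> bool" where
  "bin21_legal S \<longleftrightarrow> finite S \<and>
     (\<forall>i\<in>S. \<forall>j\<in>S. i \<noteq> j \<longrightarrow>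
        bin_of i \<noteq> bin_of j \<and> \<not> adjacent_bins (bin_of i) (bin_of j))"

definition bin21_legal_decomposition :: "(nat \<Rightarrow> nat) \<Rightarrow> nat \<Rightarrow> nat set \<Rightarrow> bool" where
  "bin21_legal_decomposition a n S \<longleftrightarrow> bin21_legal S \<and> n = (\<Sum>i\<in>S. a i)"

definition is_bin21_sequence :: "(nat \<Rightarrow> nat) \<Rightarrow> bool" where
  "is_bin21_sequence a \<longleftrightarrow>
     strict_mono a \<and> (\<forall>x. 0 < a x) \<and> (\<forall>n>0. \<exists>!S. bin21_legal_decomposition a n S)"

definition bin21_sequence :: "nat \<Rightarrow> nat" where
  "bin21_sequence = (THE a. is_bin21_sequence a)"

text \<open>The sequence \<open>H\<close> is indexed from \<open>1\<close>; the value \<open>H 0\<close> is irrelevant, and so are the values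
  of \<open>c\<close> outside \<open>{1..L}\<close>. The subtractions below never truncate.\<close>

definition is_PLRS :: "(nat \<Rightarrow> nat) \<Rightarrow> bool" where
  "is_PLRS H \<longleftrightarrow> (\<forall>j\<ge>1. 0 < H j) \<and>
     (\<exists>(L::nat) (c::nat \<Rightarrow> nat).
        0 < L \<and> 0 < c 1 \<and> 0 < c L \<and>
        (\<forall>j\<ge>L. H (j + 1) = (\<Sum>i=1..L. c i * H (j + 1 - i))) \<and>
        H 1 = 1 \<and>
        (\<forall>j. 1 \<le> j \<and> j < L \<longrightarrow> H (j + 1) = (\<Sum>i=1..j. c i * H (j + 1 - i)) + 1))"

text \<open>The remainder shows that the description in \<open>bin21_sequence_def\<close> denotes: there is exactly
  one such sequence.\<close>

lemma bin21_sequence_le: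
  assumes a: "is_bin21_sequence a" and b: "is_bin21_sequence b"
    and eq: "\<forall>i<n. a i = b i"
  shows "b n \<le> a n"
proof (rule ccontr)
  assume "\<not> b n \<le> a n"
  then have less: "a n < b n" by simp
  have pos: "0 < a n" using a by (simp add: is_bin21_sequence_def)
  obtain S where S: "bin21_legal S" "a n = (\<Sum>i\<in>S. b i)"
    using b pos unfolding is_bin21_sequence_def bin21_legal_decomposition_def by blast
  have fin: "finite S" using S(1) by (simp add: bin21_legal_def)
  have S_less: "i < n" if "i \<in> S" for i
  proof -
    have "b i \<le> a n" using S(2) member_le_sum[OF that, of b] fin by simp
    then have "b i < b n" using less by simp
    then show ?thesis using b by (simp add: is_bin21_sequence_def strict_mono_less)
  qed
  have "(\<Sum>i\<in>S. a i) = a n" using S(2) S_less eq by simp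
  then have "bin21_legal_decomposition a (a n) S"
    using S(1) by (simp add: bin21_legal_decomposition_def)
  moreover have "bin21_legal_decomposition a (a n) {n}"
    by (simp add: bin21_legal_decomposition_def bin21_legal_def)
  moreover have "\<exists>!S. bin21_legal_decomposition a (a n) S"
    using a pos by (simp add: is_bin21_sequence_def)
  ultimately have "S = {n}" by blast
  then show False using S_less by blast
qed

lemma bin21_sequence_unique:
  assumes "is_bin21_sequence a" "is_bin21_sequence b"
  shows "a = b"
proof
  fix n show "a n = b n"
  proof (induction n rule: less_induct)
    case (less n)
    then show ?case
      using bin21_sequence_le[OF assms, of n] bin21_sequence_le[OF assms(2,1), of n] by force
  qed
qed

definition first_prev :: "nat \<Rightarrow> nat" where
  "first_prev n = (if n mod 3 = 0 then n - 1 else n - 2)"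

lemma first_prev_le [termination_simp]: "first_prev n \<le> n"
  by (simp add: first_prev_def)

fun bin21_rec :: "nat \<Rightarrow> nat" where
  "bin21_rec 0 = 1"
| "bin21_rec (Suc n) = bin21_rec n + bin21_rec (first_prev n)"

lemma bin21_rec_pos: "0 < bin21_rec n"
  by (induction n) auto

lemma less_first_prev_iff:
  assumes "i < n"
  shows "i < first_prev n \<longleftrightarrow>
    bin_of i \<noteq> bin_of n \<and> \<not> adjacent_bins (bin_of i) (bin_of n)"
proof -
  define q r where "q = n div 3" and "r = n mod 3"
  define s t where "s = i div 3" and "t = i mod 3"
  have n: "n = 3 * q + r" and r: "r < 3" by (simp_all add: q_def r_def)
  have i: "i = 3 * s + t" and t: "t < 3" by (simp_all add: s_def t_def)
  show ?thesis
    using assms n r i t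
    unfolding first_prev_def bin_of_def adjacent_bins_def
      q_def[symmetric] r_def[symmetric] s_def[symmetric] t_def[symmetric]
    by (auto split: if_splits)
qed

lemma bin21_legal_subset: "bin21_legal S \<Longrightarrow> T \<subseteq> S \<Longrightarrow> bin21_legal T"
  unfolding bin21_legal_def by (meson finite_subset subset_iff)

lemma bin21_legal_below:
  assumes "bin21_legal S" "S \<subseteq> {..<Suc n}" "n \<in> S"
  shows "S - {n} \<subseteq> {..<first_prev n}"
proof
  fix i assume i: "i \<in> S - {n}"
  then have "i < n" using assms(2) by (auto simp: less_Suc_eq)
  then show "i \<in> {..<first_prev n}"
    using i assms(1,3) less_first_prev_iff[of i n] by (auto simp: bin21_legal_def)
qed

lemma bin21_legal_insert:
  assumes S: "bin21_legal S" "S \<subseteq> {..<first_prev n}"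
  shows "bin21_legal (insert n S)"
proof -
  have "bin_of i \<noteq> bin_of n \<and> \<not> adjacent_bins (bin_of i) (bin_of n)" if "i \<in> S" for i
    using that S(2) first_prev_le[of n] less_first_prev_iff[of i n] by force
  then show ?thesis
    using S(1) unfolding bin21_legal_def adjacent_bins_def by (metis finite_insert insert_iff)
qed

lemma sum_bin21_rec_less:
  "bin21_legal S \<Longrightarrow> S \<subseteq> {..<n} \<Longrightarrow> (\<Sum>i\<in>S. bin21_rec i) < bin21_rec n"
proof (induction n arbitrary: S rule: less_induct)
  case (less n)
  show ?case
  proof (cases n)
    case 0
    then show ?thesis using less.prems by simp
  next
    case (Suc m)
    show ?thesis
    proof (cases "m \<in> S")
      case True
      have fin: "finite S" using less.prems by (simp add: bin21_legal_def)
      have "(\<Sum>i\<in>S - {m}. bin21_rec i) < bin21_rec (first_prev m)"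
        using less.prems True Suc bin21_legal_below[of S m] bin21_legal_subset[of S "S - {m}"]
          first_prev_le[of m]
        by (intro less.IH) auto
      then show ?thesis using Suc sum.remove[OF fin True, of bin21_rec] by simp
    next
      case False
      then have "S \<subseteq> {..<m}" using less.prems Suc by (auto simp: less_Suc_eq)
      then have "(\<Sum>i\<in>S. bin21_rec i) < bin21_rec m" using less Suc by simp
      then show ?thesis using Suc by simp
    qed
  qed
qed

lemma ex_bin21_rec_sum:
  "k < bin21_rec n \<Longrightarrow> \<exists>S. bin21_legal S \<and> S \<subseteq> {..<n} \<and> (\<Sum>i\<in>S. bin21_rec i) = k"
proof (induction n arbitrary: k rule: less_induct)
  case (less n)
  show ?case
  proof (cases n)
    case 0
    then show ?thesis using less.prems by (intro exI[of _ "{}"]) (simp add: bin21_legal_def)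
  next
    case (Suc m)
    show ?thesis
    proof (cases "k < bin21_rec m")
      case True
      then show ?thesis using less.IH[of m k] Suc by fastforce
    next
      case False
      then have "k - bin21_rec m < bin21_rec (first_prev m)"
        using less.prems Suc by simp
      then obtain S where S: "bin21_legal S" "S \<subseteq> {..<first_prev m}"
        "(\<Sum>i\<in>S. bin21_rec i) = k - bin21_rec m"
        using less.IH[of "first_prev m"] Suc first_prev_le[of m] by (auto simp: less_Suc_eq_le)
      have notin: "m \<notin> S" using S(2) first_prev_le[of m] by auto
      have fin: "finite S" using S(1) by (simp add: bin21_legal_def)
      have "(\<Sum>i\<in>insert m S. bin21_rec i) = k" using S(3) fin notin False by simp
      moreover have "insert m S \<subseteq> {..<n}" using S(2) first_prev_le[of m] Suc by auto
      ultimately show ?thesis using bin21_legal_insert[OF S(1,2)] by blast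
    qed
  qed
qed

lemma sum_bin21_rec_inj:
  "bin21_legal S \<Longrightarrow> bin21_legal T \<Longrightarrow> S \<subseteq> {..<n} \<Longrightarrow> T \<subseteq> {..<n} \<Longrightarrow>
    (\<Sum>i\<in>S. bin21_rec i) = (\<Sum>i\<in>T. bin21_rec i) \<Longrightarrow> S = T"
proof (induction n arbitrary: S T)
  case 0
  then show ?case by simp
next
  case (Suc m)
  have mem: "m \<in> U \<longleftrightarrow> bin21_rec m \<le> (\<Sum>i\<in>U. bin21_rec i)"
    if U: "bin21_legal U" "U \<subseteq> {..<Suc m}" for U
  proof
    assume "m \<in> U"
    then show "bin21_rec m \<le> (\<Sum>i\<in>U. bin21_rec i)"
      using U(1) member_le_sum[of m U bin21_rec] by (simp add: bin21_legal_def)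
  next
    assume le: "bin21_rec m \<le> (\<Sum>i\<in>U. bin21_rec i)"
    show "m \<in> U"
    proof (rule ccontr)
      assume "m \<notin> U"
      then have "U \<subseteq> {..<m}" using U(2) by (auto simp: less_Suc_eq)
      then show False using sum_bin21_rec_less[OF U(1), of m] le by simp
    qed
  qed
  have iff: "m \<in> S \<longleftrightarrow> m \<in> T" using mem Suc.prems by simp
  have fin: "finite S" "finite T" using Suc.prems by (simp_all add: bin21_legal_def)
  have "S - {m} = T - {m}"
  proof (rule Suc.IH)
    show "bin21_legal (S - {m})" "bin21_legal (T - {m})"
      using Suc.prems(1,2) bin21_legal_subset by blast+
    show "S - {m} \<subseteq> {..<m}" "T - {m} \<subseteq> {..<m}"
      using Suc.prems(3,4) by (auto simp: less_Suc_eq)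
    show "(\<Sum>i\<in>S - {m}. bin21_rec i) = (\<Sum>i\<in>T - {m}. bin21_rec i)"
    proof (cases "m \<in> S")
      case True
      then show ?thesis
        using iff Suc.prems(5) sum.remove[OF fin(1), of m bin21_rec]
          sum.remove[OF fin(2), of m bin21_rec] by simp
    next
      case False
      then show ?thesis using iff Suc.prems(5) by simp
    qed
  qed
  then show ?case using iff by blast
qed

lemma strict_mono_bin21_rec: "strict_mono bin21_rec"
  by (simp add: strict_mono_Suc_iff bin21_rec_pos)

lemma is_bin21_sequence_bin21_rec: "is_bin21_sequence bin21_rec"
proof -
  have "\<exists>!S. bin21_legal_decomposition bin21_rec n S" for n
  proof (rule ex_ex1I)
    have "n < bin21_rec (Suc n)"
      using strict_mono_imp_increasing[OF strict_mono_bin21_rec, of "Suc n"] by simp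
    then show "\<exists>S. bin21_legal_decomposition bin21_rec n S"
      using ex_bin21_rec_sum by (fastforce simp: bin21_legal_decomposition_def)
  next
    fix S T
    assume S: "bin21_legal_decomposition bin21_rec n S"
      and T: "bin21_legal_decomposition bin21_rec n T"
    then have "finite (S \<union> T)" by (simp add: bin21_legal_decomposition_def bin21_legal_def)
    then obtain k where "S \<union> T \<subseteq> {..<k}"
      unfolding finite_nat_set_iff_bounded by blast
    then show "S = T"
      using S T sum_bin21_rec_inj[of S T k] by (simp add: bin21_legal_decomposition_def)
  qed
  then show ?thesis
    using strict_mono_bin21_rec bin21_rec_pos by (simp add: is_bin21_sequence_def)
qed

lemma ex1_bin21_sequence: "\<exists>!a. is_bin21_sequence a"
  using is_bin21_sequence_bin21_rec bin21_sequence_unique by blast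

lemma is_bin21_sequence_bin21_sequence: "is_bin21_sequence bin21_sequence"
  unfolding bin21_sequence_def using ex1_bin21_sequence by (rule theI')

end

theory Submission
  imports Defs Complex_Main
begin

text \<open>With period 3 the bin sequence satisfies \<open>a (n + 6) = 4 * a (n + 3) - 2 * a n\<close>, whose
  characteristic roots are \<open>2 + sqrt 2\<close> and \<open>2 - sqrt 2\<close>. The combination
  \<open>u n = a (n + 3) - (2 - sqrt 2) * a n\<close> keeps only the dominant root, so the ratios
  \<open>u (n + 1) / u n\<close> are exactly 3-periodic, with values \<open>1 + sqrt 2 / 2\<close>, \<open>sqrt 2\<close>, \<open>sqrt 2\<close>.
  Every linear recurrence satisfied by \<open>a\<close> is satisfied by \<open>u\<close>. If its coefficients are nonnegative
  then, at \<open>3\<close> dividing \<open>j\<close>, the ratio \<open>u (j + 1) / u j\<close>, which is the largest ratio, is a weighted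
  mean of earlier ratios; a positive first coefficient gives positive weight to a smaller one.\<close>

lemma bin21_sequence_eq_rec: "bin21_sequence = bin21_rec"
  by (rule bin21_sequence_unique[OF is_bin21_sequence_bin21_sequence is_bin21_sequence_bin21_rec])

lemma bin21_rec_steps:
  "bin21_rec (3 * k + 4) = bin21_rec (3 * k + 3) + bin21_rec (3 * k + 2)"
  "bin21_rec (3 * k + 5) = bin21_rec (3 * k + 4) + bin21_rec (3 * k + 2)"
  "bin21_rec (3 * k + 3) = bin21_rec (3 * k + 2) + bin21_rec (3 * k)"
proof -
  have "first_prev (3 * k + 3) = 3 * k + 2" "first_prev (3 * k + 4) = 3 * k + 2"
    "first_prev (3 * k + 2) = 3 * k"
    by (simp_all add: first_prev_def mod_simps) presburger+
  then show "bin21_rec (3 * k + 4) = bin21_rec (3 * k + 3) + bin21_rec (3 * k + 2)"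
    "bin21_rec (3 * k + 5) = bin21_rec (3 * k + 4) + bin21_rec (3 * k + 2)"
    "bin21_rec (3 * k + 3) = bin21_rec (3 * k + 2) + bin21_rec (3 * k)"
    using bin21_rec.simps(2)[of "3 * k + 3"] bin21_rec.simps(2)[of "3 * k + 4"]
      bin21_rec.simps(2)[of "3 * k + 2"]
    by (simp_all add: eval_nat_numeral)
qed

lemma bin21_rec_init:
  "bin21_rec 1 = 2" "bin21_rec 2 = 3" "bin21_rec 3 = 4" "bin21_rec 4 = 7" "bin21_rec 5 = 10"
proof -
  show one: "bin21_rec 1 = 2" by (simp add: first_prev_def)
  have "bin21_rec (Suc 1) = 3" using one by (simp add: first_prev_def)
  then show two: "bin21_rec 2 = 3" by (simp only: Suc_1)
  show "bin21_rec 3 = 4" "bin21_rec 4 = 7" "bin21_rec 5 = 10"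
    using bin21_rec_steps[of 0] two by (simp_all del: bin21_rec.simps(2) add_2_eq_Suc')
qed

text \<open>For \<open>k = m + 1\<close>, two expansions give
  \<open>a (3m+6) = a (3m+4) + (a (3m+2) + a (3m+3))\<close>, and the bracket is again
  \<open>a (3m+4)\<close>.\<close>

lemma bin21_rec_mult_3_double: "bin21_rec (3 * k + 3) = 2 * bin21_rec (3 * k + 1)"
proof (cases k)
  case 0
  then show ?thesis using bin21_rec_init by simp
next
  case (Suc m)
  have idx: "3 * k + 1 = 3 * m + 4" "3 * k + 3 = 3 * m + 6"
    using Suc by simp_all
  have "bin21_rec (3 * m + 6) = bin21_rec (3 * m + 5) + bin21_rec (3 * m + 3)"
    using bin21_rec_steps(3)[of "m + 1"] by (simp add: ac_simps)
  then show ?thesis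
    unfolding idx using bin21_rec_steps(1,2)[of m] by linarith
qed

text \<open>In each residue class mod 3 this is a linear consequence of the one-step relations and
  the doubling relation. The additive form avoids truncated subtraction.\<close>

lemma bin21_rec_linear_recurrence:
  "bin21_rec (n + 6) + 2 * bin21_rec n = 4 * bin21_rec (n + 3)"
proof -
  have "\<exists>k. n = 3 * k \<or> n = 3 * k + 1 \<or> n = 3 * k + 2" by presburger
  then obtain k where n: "n = 3 * k \<or> n = 3 * k + 1 \<or> n = 3 * k + 2" by blast
  have idx: "3 * (k + 1) + 1 = 3 * k + 4" "3 * (k + 1) + 2 = 3 * k + 5"
    "3 * (k + 1) + 3 = 3 * k + 6" "3 * (k + 1) + 4 = 3 * k + 7" "3 * (k + 1) + 5 = 3 * k + 8"
    by simp_all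
  note steps = bin21_rec_steps(1,2)[of k] bin21_rec_steps(1,2)[of "k + 1", unfolded idx]
    bin21_rec_steps(3)[of k] bin21_rec_mult_3_double[of k]
    bin21_rec_mult_3_double[of "k + 1", unfolded idx]
  have "bin21_rec (3 * k + 6) + 2 * bin21_rec (3 * k) = 4 * bin21_rec (3 * k + 3)"
    "bin21_rec (3 * k + 7) + 2 * bin21_rec (3 * k + 1) = 4 * bin21_rec (3 * k + 4)"
    "bin21_rec (3 * k + 8) + 2 * bin21_rec (3 * k + 2) = 4 * bin21_rec (3 * k + 5)"
    using steps by linarith+
  moreover have "3 * k + 1 + 6 = 3 * k + 7" "3 * k + 2 + 6 = 3 * k + 8"
    "3 * k + 1 + 3 = 3 * k + 4" "3 * k + 2 + 3 = 3 * k + 5"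
    by simp_all
  ultimately show ?thesis using n by metis
qed

definition dominant_part :: "nat \<Rightarrow> real" where
  "dominant_part n = real (bin21_rec (n + 3)) - (2 - sqrt 2) * real (bin21_rec n)"

text \<open>The roots \<open>2 + sqrt 2\<close> and \<open>2 - sqrt 2\<close> have sum 4 and product
  2.\<close>

lemma dominant_part_add_3: "dominant_part (n + 3) = (2 + sqrt 2) * dominant_part n"
proof -
  have "real (bin21_rec (n + 6)) = 4 * real (bin21_rec (n + 3)) - 2 * real (bin21_rec n)"
    using arg_cong[OF bin21_rec_linear_recurrence[of n], of real] by simp
  then show ?thesis by (simp add: dominant_part_def algebra_simps)
qed

lemma dominant_part_mult_3:
  "dominant_part (3 * k + r) = (2 + sqrt 2) ^ k * dominant_part r"
proof (induction k)
  case (Suc k)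
  then show ?case using dominant_part_add_3[of "3 * k + r"] by (simp add: algebra_simps)
qed simp

lemma dominant_part_init:
  "dominant_part 0 = 2 + sqrt 2" "dominant_part 1 = 3 + 2 * sqrt 2"
  "dominant_part 2 = 4 + 3 * sqrt 2" "dominant_part 3 = 6 + 4 * sqrt 2"
  \<comment> \<open>The recurrence at 0 supplies \<open>bin21_rec 6 = 14\<close>, needed for
    \<open>dominant_part 3\<close>.\<close>
  using bin21_rec_linear_recurrence[of 0] bin21_rec_init
  by (simp_all add: dominant_part_def algebra_simps del: One_nat_def)

text \<open>Scaling reduces this to \<open>k = 0\<close>, where
  \<open>2 * (3 + 2 * sqrt 2) = (2 + sqrt 2)^2\<close>.\<close>

lemma dominant_part_ratio_max:
  "2 * dominant_part (3 * k + 1) = (2 + sqrt 2) * dominant_part (3 * k)"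
  using dominant_part_mult_3[of k 0] dominant_part_mult_3[of k 1] dominant_part_init
  by (simp add: algebra_simps)

lemma dominant_part_ratio_less:
  assumes "n mod 3 \<noteq> 0"
  shows "2 * dominant_part (n + 1) < (2 + sqrt 2) * dominant_part n"
proof -
  define k where "k = n div 3"
  have "2 * dominant_part (r + 1) < (2 + sqrt 2) * dominant_part r" if "r = 1 \<or> r = 2" for r
  proof -
    have "0 < sqrt (2::real)" by simp
    \<comment> \<open>These are the differences of the two sides for \<open>r = 1\<close> and
      \<open>r = 2\<close>.\<close>
    then have "0 < 2 + sqrt (2::real)" "0 < 2 + 2 * sqrt (2::real)" by linarith+
    then show ?thesis
      using that dominant_part_init by (auto simp: algebra_simps eval_nat_numeral)
  qed
  moreover obtain r where r: "n = 3 * k + r" "r = 1 \<or> r = 2"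
    using assms that[of "n mod 3"] mod_less_divisor[of 3 n] unfolding k_def by fastforce
  ultimately have "(2 + sqrt 2) ^ k * (2 * dominant_part (r + 1)) <
      (2 + sqrt 2) ^ k * ((2 + sqrt 2) * dominant_part r)"
    by (intro mult_strict_left_mono) (auto intro!: zero_less_power add_pos_pos)
  then show ?thesis
    using dominant_part_mult_3[of k r] dominant_part_mult_3[of k "r + 1"]
    by (simp add: r(1) algebra_simps)
qed

lemma dominant_part_ratio_le: "2 * dominant_part (n + 1) \<le> (2 + sqrt 2) * dominant_part n"
proof (cases "n mod 3 = 0")
  case True
  then obtain k where "n = 3 * k" by (auto simp: mod_eq_0_iff_dvd)
  then show ?thesis using dominant_part_ratio_max[of k] by simp
next
  case False
  then show ?thesis using dominant_part_ratio_less[of n] by simp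
qed

text \<open>\<open>dominant_part\<close> is a fixed linear combination of the sequence and its shift
  by 3, and both satisfy the recurrence.\<close>

lemma dominant_part_recurrence:
  fixes c :: "nat \<Rightarrow> nat"
  assumes rec: "\<And>j. L \<le> j \<Longrightarrow> bin21_rec j = (\<Sum>i=1..L. c i * bin21_rec (j - i))"
    and "L \<le> j"
  shows "dominant_part j = (\<Sum>i=1..L. real (c i) * dominant_part (j - i))"
proof -
  have "real (bin21_rec j) = (\<Sum>i=1..L. real (c i) * real (bin21_rec (j - i)))"
    using rec[OF assms(2)] by simp
  moreover have "real (bin21_rec (j + 3)) = (\<Sum>i=1..L. real (c i) * real (bin21_rec (j - i + 3)))"
    using rec[of "j + 3"] assms(2) by (auto intro!: sum.cong)
  ultimately show ?thesis
    unfolding dominant_part_def by (simp add: sum_distrib_left sum_subtractf sum.distrib algebra_simps)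
qed

lemma bin21_rec_no_positive_recurrence:
  fixes c :: "nat \<Rightarrow> nat"
  assumes "0 < L" "0 < c 1"
    and rec: "\<And>j. L \<le> j \<Longrightarrow> bin21_rec j = (\<Sum>i=1..L. c i * bin21_rec (j - i))"
  shows False
proof -
  \<comment> \<open>A multiple of 3 that is at least \<open>L\<close>: the ratio at \<open>j\<close>
    is maximal and the recurrence applies at \<open>j\<close> and \<open>j + 1\<close>.\<close>
  define j where "j = 3 * L"
  have Lj: "L \<le> j" by (simp add: j_def)
  have "2 * dominant_part (j + 1) = (\<Sum>i=1..L. real (c i) * (2 * dominant_part (j - i + 1)))"
    using dominant_part_recurrence[OF rec, of "j + 1"] Lj
    by (auto simp: sum_distrib_left Suc_diff_le intro!: sum.cong)
  also have "\<dots> < (\<Sum>i=1..L. real (c i) * ((2 + sqrt 2) * dominant_part (j - i)))"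
  proof (rule sum_strict_mono_ex1)
    show "\<forall>i\<in>{1..L}. real (c i) * (2 * dominant_part (j - i + 1))
        \<le> real (c i) * ((2 + sqrt 2) * dominant_part (j - i))"
      by (intro ballI mult_left_mono dominant_part_ratio_le) simp
    \<comment> \<open>The term \<open>i = 1\<close> is strict: \<open>j - 1\<close> has residue 2
      and \<open>c 1\<close> is positive.\<close>
    have "(j - 1) mod 3 \<noteq> 0" using assms(1) unfolding j_def by presburger
    then show "\<exists>i\<in>{1..L}. real (c i) * (2 * dominant_part (j - i + 1))
        < real (c i) * ((2 + sqrt 2) * dominant_part (j - i))"
      using assms(1,2) dominant_part_ratio_less[of "j - 1"] Lj
      by (intro bexI[of _ 1] mult_strict_left_mono) auto
  qed simp
  also have "\<dots> = (2 + sqrt 2) * dominant_part j"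
    using dominant_part_recurrence[OF rec Lj] by (simp add: sum_distrib_left algebra_simps)
  finally show False using dominant_part_ratio_max[of L] by (simp add: j_def)
qed

theorem propositionA1:
  "\<not> is_PLRS (\<lambda>j. bin21_sequence (j - 1))"
proof
  assume "is_PLRS (\<lambda>j. bin21_sequence (j - 1))"
  then obtain L c where Lc: "0 < L" "0 < c 1"
    \<comment> \<open>With \<open>H j = a (j - 1)\<close>, the terms \<open>H (j + 1)\<close> and
      \<open>H (j + 1 - i)\<close> become \<open>a j\<close> and \<open>a (j - i)\<close>.\<close>
    and rec: "\<And>j. L \<le> j \<Longrightarrow> bin21_rec j = (\<Sum>i=1..L. c i * bin21_rec (j - i))"
    unfolding is_PLRS_def bin21_sequence_eq_rec by auto
  show False by (rule bin21_rec_no_positive_recurrence[OF Lc rec])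
qed

end
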